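(* Let $X$ be a connected compact metric space, $\Phi$ a continuous semiflow on $X$, and $\xi$ a time-Lipschitz continuous observable cocycle for $(X,\Phi)$ with values in $\mathbb{R}^m$. Then the rotation set $R$ of $(X,\Phi,\xi)$ is connected.
   Context: A continuous semiflow on $X$ is a continuous map $\Phi:[0,\infty)\times X\to X$ with $\Phi(0,x)=x$ and $\Phi(s+t,x)=\Phi(t,\Phi(s,x))$ for all $x\in X$, $s,t\in[0,\infty)$; write $\Phi^t(x)=\Phi(t,x)$. A time-Lipschitz continuous observable cocycle with values in $\mathbb{R}^m$ is a continuous function $\xi:[0,\infty)\times X\to\mathbb{R}^m$ such that $\xi(s+t,x)=\xi(s,\Phi^t(x))+\xi(t,x)$ for all $s,t\ge 0$, $x\in X$, and $\|\xi(t,x)\|\le Lt$ for some constant $L$ independent of $t$ and $x$. The rotation set $R$ of $(X,\Phi,\xi)$ is the set of all limits $\lim_{n\to\infty}\xi(t_n,x_n)/t_n$, where $x_n\in X$ and $\lim_{n\to\infty}t_n=\infty$. *)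

theory Defs
  imports "HOL-Analysis.Analysis"
begin

text \<open>
  Time is a real number and the phase space is a subset of a metric space type, so the functions
  below are total; only their values for nonnegative times and points of the phase space matter.
\<close>

definition continuous_semiflow :: "'a::metric_space set \<Rightarrow> (real \<Rightarrow> 'a \<Rightarrow> 'a) \<Rightarrow> bool" where
  "continuous_semiflow X \<Phi> \<longleftrightarrow>
     (\<forall>t\<ge>0. \<forall>x\<in>X. \<Phi> t x \<in> X) \<and>
     continuous_on ({0..} \<times> X) (\<lambda>(t, x). \<Phi> t x) \<and>
     (\<forall>x\<in>X. \<Phi> 0 x = x) \<and>
     (\<forall>s\<ge>0. \<forall>t\<ge>0. \<forall>x\<in>X. \<Phi> (s + t) x = \<Phi> t (\<Phi> s x))"

definition time_Lipschitz_cocycle ::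
  "'a::metric_space set \<Rightarrow> (real \<Rightarrow> 'a \<Rightarrow> 'a) \<Rightarrow> (real \<Rightarrow> 'a \<Rightarrow> real ^ 'm) \<Rightarrow> bool" where
  "time_Lipschitz_cocycle X \<Phi> \<xi> \<longleftrightarrow>
     continuous_on ({0..} \<times> X) (\<lambda>(t, x). \<xi> t x) \<and>
     (\<forall>s\<ge>0. \<forall>t\<ge>0. \<forall>x\<in>X. \<xi> (s + t) x = \<xi> s (\<Phi> t x) + \<xi> t x) \<and>
     (\<exists>L. \<forall>t\<ge>0. \<forall>x\<in>X. norm (\<xi> t x) \<le> L * t)"

text \<open>
  The times are required to be positive so that every quotient is defined; as they tend to
  infinity, this restricts only finitely many terms and does not change the set of limits.
  The semiflow enters only through the cocycle.
\<close>

definition rotation_set :: "'a::metric_space set \<Rightarrow> (real \<Rightarrow> 'a \<Rightarrow> real ^ 'm) \<Rightarrow> (real ^ 'm) set" where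
  "rotation_set X \<xi> =
     {v. \<exists>(t :: nat \<Rightarrow> real) (x :: nat \<Rightarrow> 'a).
           (\<forall>n. t n > 0 \<and> x n \<in> X) \<and>
           filterlim t at_top sequentially \<and>
           (\<lambda>n. \<xi> (t n) (x n) /\<^sub>R t n) \<longlonglongrightarrow> v}"

end

theory Submission
  imports Defs
begin

text \<open>
  For \<open>n\<close> a natural number, let \<open>S n\<close> be the set of all averages \<open>\<xi> t x /\<^sub>R t\<close> with \<open>t > n\<close> and
  \<open>x\<close> in \<open>X\<close>. It is the image of the connected set \<open>{n<..} \<times> X\<close> under a continuous map, hence
  connected, and the Lipschitz bound on the cocycle keeps it in a ball whose radius does not depend
  on \<open>n\<close>. The closures of the sets \<open>S n\<close> are therefore a decreasing sequence of compact connected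
  sets, and such a sequence has a connected intersection. That intersection is the rotation set:
  a vector lies in every closure exactly when averages over arbitrarily long times come arbitrarily
  close to it (\<open>rotation_set_eq_Inter_closure\<close>).
\<close>

definition late_averages :: "'a::metric_space set \<Rightarrow> (real \<Rightarrow> 'a \<Rightarrow> real ^ 'm) \<Rightarrow> nat \<Rightarrow> (real ^ 'm) set"
  where "late_averages X \<xi> n = (\<lambda>(t, x). \<xi> t x /\<^sub>R t) ` ({real n<..} \<times> X)"

lemma late_averages_antimono:
  assumes "m \<le> n"
  shows "late_averages X \<xi> n \<subseteq> late_averages X \<xi> m"
  using assms unfolding late_averages_def by (intro image_mono) auto

text \<open>
  The tail of a sequence witnessing that \<open>v\<close> is a rotation vector lies in each set of late averages.
  Conversely, if \<open>v\<close> is in all the closures, choosing from the set with index \<open>n\<close> an average at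
  distance less than \<open>1 / (n + 1)\<close> from \<open>v\<close> gives such a sequence, since the times chosen exceed \<open>n\<close>.
\<close>

lemma rotation_set_eq_Inter_closure:
  "rotation_set X \<xi> = (\<Inter>n. closure (late_averages X \<xi> n))"
proof (intro equalityI subsetI INT_I)
  fix v n
  assume "v \<in> rotation_set X \<xi>"
  then obtain t x where tx: "\<And>k. t k > 0 \<and> x k \<in> X"
      and t: "filterlim t at_top sequentially"
      and lim: "(\<lambda>k. \<xi> (t k) (x k) /\<^sub>R t k) \<longlonglongrightarrow> v"
    unfolding rotation_set_def by blast
  have "\<forall>\<^sub>F k in sequentially. t k > real n"
    using t by (simp add: filterlim_at_top_dense)
  then have "\<forall>\<^sub>F k in sequentially. \<xi> (t k) (x k) /\<^sub>R t k \<in> closure (late_averages X \<xi> n)"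
  proof eventually_elim
    case (elim k)
    then have "\<xi> (t k) (x k) /\<^sub>R t k \<in> late_averages X \<xi> n"
      using tx[of k] unfolding late_averages_def by (intro image_eqI[of _ _ "(t k, x k)"]) auto
    then show ?case
      using closure_subset by blast
  qed
  then show "v \<in> closure (late_averages X \<xi> n)"
    using Lim_in_closed_set[OF closed_closure _ sequentially_bot lim] by blast
next
  fix v
  assume v: "v \<in> (\<Inter>n. closure (late_averages X \<xi> n))"
  have "\<exists>t x. t > real n \<and> x \<in> X \<and> dist (\<xi> t x /\<^sub>R t) v < inverse (real (Suc n))" for n
  proof -
    have "v \<in> closure (late_averages X \<xi> n)"
      using v by blast
    then obtain w where "w \<in> late_averages X \<xi> n" "dist w v < inverse (real (Suc n))"
      unfolding closure_approachable by (metis inverse_positive_iff_positive of_nat_0_less_iff zero_less_Suc)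
    then show ?thesis
      unfolding late_averages_def by auto
  qed
  then obtain t x where tx: "\<And>n. t n > real n \<and> x n \<in> X"
      and d: "\<And>n. dist (\<xi> (t n) (x n) /\<^sub>R t n) v < inverse (real (Suc n))"
    by metis
  have "(\<lambda>n. dist (\<xi> (t n) (x n) /\<^sub>R t n) v) \<longlonglongrightarrow> 0"
    by (rule tendsto_sandwich[OF _ _ tendsto_const LIMSEQ_inverse_real_of_nat])
      (use d in \<open>auto intro!: always_eventually less_imp_le\<close>)
  then have "(\<lambda>n. \<xi> (t n) (x n) /\<^sub>R t n) \<longlonglongrightarrow> v"
    using tendsto_dist_iff by blast
  moreover have "filterlim t at_top sequentially"
    by (rule filterlim_at_top_mono[OF filterlim_real_sequentially])
      (use tx in \<open>auto intro!: always_eventually less_imp_le\<close>)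
  moreover have "t n > 0 \<and> x n \<in> X" for n
    using tx[of n] by (meson le_less_trans of_nat_0_le_iff)
  ultimately show "v \<in> rotation_set X \<xi>"
    unfolding rotation_set_def by blast
qed

lemma connected_late_averages:
  assumes "connected X" and "continuous_on ({0..} \<times> X) (\<lambda>(t, x). \<xi> t x)"
  shows "connected (late_averages X \<xi> n)"
proof -
  have "continuous_on ({real n<..} \<times> X) (\<lambda>(t, x). \<xi> t x)"
    by (rule continuous_on_subset[OF assms(2)]) (auto intro: order.trans[OF of_nat_0_le_iff less_imp_le])
  then have "continuous_on ({real n<..} \<times> X) (\<lambda>(t, x). \<xi> t x /\<^sub>R t)"
    unfolding case_prod_beta by (intro continuous_intros) (auto simp: not_less)
  moreover have "connected ({real n<..} \<times> X)"
    by (intro connected_Times assms(1)) simp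
  ultimately show ?thesis
    unfolding late_averages_def by (rule connected_continuous_image)
qed

lemma bounded_late_averages:
  assumes "\<And>t x. t \<ge> 0 \<Longrightarrow> x \<in> X \<Longrightarrow> norm (\<xi> t x) \<le> L * t"
  shows "bounded (late_averages X \<xi> n)"
proof (rule boundedI)
  fix v
  assume "v \<in> late_averages X \<xi> n"
  then obtain t x where v: "v = \<xi> t x /\<^sub>R t" and "t > real n" "x \<in> X"
    unfolding late_averages_def by auto
  moreover from this have "t > 0"
    by (meson le_less_trans of_nat_0_le_iff)
  ultimately show "norm v \<le> L"
    using assms[of t x] by (simp add: field_simps)
qed

theorem theorem6p1:
  fixes X :: "'a::metric_space set"
    and \<Phi> :: "real \<Rightarrow> 'a \<Rightarrow> 'a"
    and \<xi> :: "real \<Rightarrow> 'a \<Rightarrow> real ^ 'm"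
  assumes "compact X" and "connected X"
    and "continuous_semiflow X \<Phi>"
    and "time_Lipschitz_cocycle X \<Phi> \<xi>"
  shows "connected (rotation_set X \<xi>)"
proof -
  obtain L where cont: "continuous_on ({0..} \<times> X) (\<lambda>(t, x). \<xi> t x)"
      and L: "\<And>t x. t \<ge> 0 \<Longrightarrow> x \<in> X \<Longrightarrow> norm (\<xi> t x) \<le> L * t"
    using assms(4) unfolding time_Lipschitz_cocycle_def by blast
  have "connected (\<Inter>n. closure (late_averages X \<xi> n))"
  proof (rule connected_nest)
    show "compact (closure (late_averages X \<xi> n))" for n
      using bounded_late_averages[OF L] by (simp add: compact_closure)
    show "connected (closure (late_averages X \<xi> n))" for n
      by (intro connected_imp_connected_closure connected_late_averages assms(2) cont)
    show "closure (late_averages X \<xi> n) \<subseteq> closure (late_averages X \<xi> m)" if "m \<le> n" for m n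
      using that by (intro closure_mono late_averages_antimono)
  qed
  then show ?thesis
    by (simp add: rotation_set_eq_Inter_closure)
qed

end
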